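(* Let $f_1\in\mathcal F_{\mu_1,L_1}$ and $f_2\in\mathcal F_{\mu_2,L_2}$ be functions on $\mathbb R^d$ satisfying the standing assumption (A) of the context, and let $F=f_1-f_2$. Assume $\mu_1+\mu_2>0$ and $L_2+\mu_2\le 0$. Let $N\ge1$ and let $x^0,\dots,x^{N+1}$ be generated by $N+1\ge 2$ iterations of DCA started from $x^0\in\operatorname{dom}\partial f_1$. Then $$\frac12\|x^N-x^{N+1}\|^2\;\le\;\frac{F(x^0)-F(x^{N+1})}{\mu_1+\mu_2+\mu_1E_N\!\left(\frac{\mu_2}{\mu_1}\right)},$$ where $E_N(z)=\sum_{j=1}^{2N}z^{-j}$ for real $z\neq 0$.
   Context: Function class. For $\mu\in\mathbb R$ and $L\in(\mu,\infty]$, $\mathcal F_{\mu,L}$ denotes the set of proper, lower semicontinuous functions $f:\mathbb R^d\to\mathbb R\cup\{+\infty\}$ such that $f-\frac{\mu}{2}\|\cdot\|^2$ is convex and, if $L<\infty$, $f$ is finite-valued and $\frac L2\|\cdot\|^2-f$ is convex (no condition on the upper curvature if $L=\infty$). Subdifferential. For convex $f$, $\partial f(x)$ is the usual convex subdifferential. For $f\in\mathcal F_{\mu,L}$ with $\mu<0$, $\partial f(x):=\partial\tilde f(x)+\mu x$ where $\tilde f=f-\frac\mu2\|\cdot\|^2$ is convex. $\operatorname{dom}\partial f=\{x:\partial f(x)\ne\emptyset\}$ and $\operatorname{range}\partial f=\bigcup_x\partial f(x)$. Standing assumption (A). $f_1\in\mathcal F_{\mu_1,L_1}$ and $f_2\in\mathcal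 F_{\mu_2,L_2}$ with $0\le\mu_1<L_1\le\infty$, $\mu_2\in(-\infty,\infty)$, $L_2\in(\mu_2,\infty]$; $F=f_1-f_2$ (with the convention $(+\infty)-(+\infty)=+\infty$) is bounded below; $\emptyset\ne\operatorname{dom}\partial f_1\subseteq\operatorname{dom}\partial f_2$ and $\operatorname{range}\partial f_2\subseteq\operatorname{range}\partial f_1$. DCA (difference-of-convex algorithm). Given $x^k$, one iteration selects any $g_2^k\in\partial f_2(x^k)$ and any $x^{k+1}\in\arg\min_{w\in\mathbb R^d}\{f_1(w)-\langle g_2^k,w\rangle\}$. *)

theory Defs
  imports "HOL-Analysis.Analysis"
begin

text \<open>
  Extended-real-valued functions are rendered with values in \<^typ>\<open>ereal\<close>; the
  value \<^term>\<open>-\<infinity>::ereal\<close> is excluded by properness.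
\<close>

definition proper_fun :: "('a \<Rightarrow> ereal) \<Rightarrow> bool" where
  "proper_fun f \<longleftrightarrow> (\<forall>x. f x \<noteq> -\<infinity>) \<and> (\<exists>x. f x \<noteq> \<infinity>)"

definition lower_semicont :: "('a::topological_space \<Rightarrow> ereal) \<Rightarrow> bool" where
  "lower_semicont f \<longleftrightarrow> (\<forall>x. f x \<le> Liminf (nhds x) f)"

text \<open>
  Convexity, meant for functions that never take the value \<^term>\<open>-\<infinity>::ereal\<close>.
  For \<open>u = 0\<close> or \<open>v = 0\<close> the condition is trivial since \<open>0 * \<infinity> = 0\<close> in \<^typ>\<open>ereal\<close>.
  The lemma below relates it to the library notion for finite functions.
\<close>

definition ext_convex :: "('a::real_vector \<Rightarrow> ereal) \<Rightarrow> bool" where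
  "ext_convex f \<longleftrightarrow>
    (\<forall>x y. \<forall>u\<ge>0. \<forall>v\<ge>0. u + v = 1 \<longrightarrow>
       f (u *\<^sub>R x + v *\<^sub>R y) \<le> ereal u * f x + ereal v * f y)"

lemma ext_convex_ereal_iff: "ext_convex (\<lambda>x. ereal (f x)) \<longleftrightarrow> convex_on UNIV f"
  by (simp add: ext_convex_def convex_on_def)

definition curv_class :: "real \<Rightarrow> ereal \<Rightarrow> ('a::euclidean_space \<Rightarrow> ereal) set" where
  "curv_class \<mu> L = {f. proper_fun f \<and> lower_semicont f \<and>
     ext_convex (\<lambda>x. f x - ereal (\<mu> / 2 * (norm x)\<^sup>2)) \<and>
     (L < \<infinity> \<longrightarrow> (\<forall>x. \<bar>f x\<bar> \<noteq> \<infinity>) \<and>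
        ext_convex (\<lambda>x. L / 2 * ereal ((norm x)\<^sup>2) - f x))}"

text \<open>
  For proper \<open>f\<close> the set below is empty at every point where \<open>f\<close> is infinite.
\<close>

definition convex_subdiff :: "('a::euclidean_space \<Rightarrow> ereal) \<Rightarrow> 'a \<Rightarrow> 'a set" where
  "convex_subdiff f x = {g. \<forall>y. f y \<ge> f x + ereal (g \<bullet> (y - x))}"

definition subdiff :: "real \<Rightarrow> ('a::euclidean_space \<Rightarrow> ereal) \<Rightarrow> 'a \<Rightarrow> 'a set" where
  "subdiff \<mu> f x =
    (if \<mu> < 0
     then (\<lambda>g. g + \<mu> *\<^sub>R x) ` convex_subdiff (\<lambda>y. f y - ereal (\<mu> / 2 * (norm y)\<^sup>2)) x
     else convex_subdiff f x)"

definition dom_subdiff :: "real \<Rightarrow> ('a::euclidean_space \<Rightarrow> ereal) \<Rightarrow> 'a set" where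
  "dom_subdiff \<mu> f = {x. subdiff \<mu> f x \<noteq> {}}"

definition range_subdiff :: "real \<Rightarrow> ('a::euclidean_space \<Rightarrow> ereal) \<Rightarrow> 'a set" where
  "range_subdiff \<mu> f = (\<Union>x. subdiff \<mu> f x)"

text \<open>
  Subtraction on \<^typ>\<open>ereal\<close> satisfies \<open>\<infinity> - \<infinity> = \<infinity>\<close>, which is the required convention.
\<close>

definition dc_fun :: "('a \<Rightarrow> ereal) \<Rightarrow> ('a \<Rightarrow> ereal) \<Rightarrow> 'a \<Rightarrow> ereal" where
  "dc_fun f1 f2 x = f1 x - f2 x"

lemma ereal_infty_minus_infty: "(\<infinity>::ereal) - \<infinity> = \<infinity>"
  by simp

definition standing_assumption ::
  "real \<Rightarrow> ereal \<Rightarrow> real \<Rightarrow> ereal \<Rightarrow> ('a::euclidean_space \<Rightarrow> ereal) \<Rightarrow> ('a \<Rightarrow> ereal) \<Rightarrow> bool" where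
  "standing_assumption \<mu>1 L1 \<mu>2 L2 f1 f2 \<longleftrightarrow>
     f1 \<in> curv_class \<mu>1 L1 \<and> f2 \<in> curv_class \<mu>2 L2 \<and>
     0 \<le> \<mu>1 \<and> ereal \<mu>1 < L1 \<and> ereal \<mu>2 < L2 \<and>
     (\<exists>c::real. \<forall>x. ereal c \<le> dc_fun f1 f2 x) \<and>
     dom_subdiff \<mu>1 f1 \<noteq> {} \<and>
     dom_subdiff \<mu>1 f1 \<subseteq> dom_subdiff \<mu>2 f2 \<and>
     range_subdiff \<mu>2 f2 \<subseteq> range_subdiff \<mu>1 f1"

definition dca_step ::
  "real \<Rightarrow> ('a::euclidean_space \<Rightarrow> ereal) \<Rightarrow> ('a \<Rightarrow> ereal) \<Rightarrow> 'a \<Rightarrow> 'a \<Rightarrow> bool" where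
  "dca_step \<mu>2 f1 f2 x x' \<longleftrightarrow>
     (\<exists>g \<in> subdiff \<mu>2 f2 x. is_arg_min (\<lambda>w. f1 w - ereal (g \<bullet> w)) (\<lambda>_. True) x')"

definition E_sum :: "nat \<Rightarrow> real \<Rightarrow> real" where
  "E_sum N z = (\<Sum>j=1..2*N. z powi (- int j))"

end

(*
  Since L2 \<le> -\<mu>2, the curvature of f2 lies in [\<mu>2, -\<mu>2], so its gradient is Lipschitz with
  constant -\<mu>2, while f1 is \<mu>1-strongly convex and the subgradient of f2 at x k is a
  subgradient of f1 at x (k+1). Hence the step lengths shrink geometrically:
  \<mu>1 |x (k+1) - x (k+2)| \<le> -\<mu>2 |x k - x (k+1)|. Each step decreases F by at least
  (\<mu>1 + \<mu>2)/2 times the squared step length; bounding all steps from below by the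
  last one and summing the geometric series gives the constant.
*)

theory Submission
  imports Defs
begin

lemma nonpos_if_le_mult_small:
  fixes a c :: real
  assumes "\<And>t. 0 < t \<Longrightarrow> t < 1 \<Longrightarrow> a \<le> t * c"
  shows "a \<le> 0"
proof (rule tendsto_lowerbound[OF _ _ trivial_limit_at_right_real])
  have "((\<lambda>t. t * c) \<longlongrightarrow> 0 * c) (at_right 0)"
    by (intro tendsto_intros)
  then show "((\<lambda>t. t * c) \<longlongrightarrow> 0) (at_right (0::real))"
    by simp
  have "\<forall>\<^sub>F t in at_right (0::real). t \<in> {0<..<1}"
    by (rule eventually_at_right_real) simp
  then show "\<forall>\<^sub>F t in at_right (0::real). a \<le> t * c"
    by eventually_elim (use assms in auto)
qed

text \<open>The lower bound lets only g act as the slope of f at x. Going from x a little away from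
  y, it bounds f below there, and convexity of L/2 |.|^2 - f turns this into an upper bound on f y
  whose error vanishes with t.\<close>

lemma quadratic_upper_bound:
  fixes f :: "'a::real_inner \<Rightarrow> real"
  assumes conv: "convex_on UNIV (\<lambda>x. L / 2 * (norm x)\<^sup>2 - f x)"
    and lower: "\<And>y. f x + g \<bullet> (y - x) - M / 2 * (norm (y - x))\<^sup>2 \<le> f y"
  shows "f y \<le> f x + g \<bullet> (y - x) + L / 2 * (norm (y - x))\<^sup>2"
proof -
  define d where "d = y - x"
  define \<delta> where "\<delta> = f y - f x - g \<bullet> d - L / 2 * (norm d)\<^sup>2"
  have "\<delta> \<le> t * ((L + M) / 2 * (norm d)\<^sup>2)" if t: "0 < t" for t
  proof -
    \<comment> \<open>The point \<open>z\<close> lies on the line from y through x, just beyond x;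
      the weights \<alpha> and \<beta> make x the convex combination of y and
      \<open>z\<close>.\<close>
    define z where "z = x - t *\<^sub>R d"
    define q where "q v = L / 2 * (norm v)\<^sup>2 - f v" for v
    define \<alpha> \<beta> where "\<alpha> = t / (1 + t)" and "\<beta> = 1 / (1 + t)"
    have \<alpha>\<beta>: "0 \<le> \<alpha>" "0 \<le> \<beta>" "\<alpha> + \<beta> = 1" "\<beta> * t = \<alpha>"
      using t by (simp_all add: \<alpha>_def \<beta>_def field_simps)
    have "\<alpha> *\<^sub>R y + \<beta> *\<^sub>R z = (\<alpha> + \<beta>) *\<^sub>R x + (\<alpha> - \<beta> * t) *\<^sub>R d"
      by (simp add: z_def d_def algebra_simps)
    then have "\<alpha> *\<^sub>R y + \<beta> *\<^sub>R z = x"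
      using \<alpha>\<beta> by simp
    moreover have "q (\<alpha> *\<^sub>R y + \<beta> *\<^sub>R z) \<le> \<alpha> * q y + \<beta> * q z"
      using conv \<alpha>\<beta>(1-3) unfolding convex_on_def q_def[symmetric] by simp
    ultimately have "q x \<le> \<alpha> * q y + \<beta> * q z"
      by metis
    also have "\<dots> = (t * q y + q z) / (1 + t)"
      by (simp add: \<alpha>_def \<beta>_def add_divide_distrib)
    finally have "(1 + t) * q x \<le> t * q y + q z"
      using t by (simp add: pos_le_divide_eq mult.commute)
    moreover have "f x - t * (g \<bullet> d) - M / 2 * (t\<^sup>2 * (norm d)\<^sup>2) \<le> f z"
      using lower[of z] by (simp add: z_def power_mult_distrib)
    \<comment> \<open>The cross terms with x and d cancel. After division by t, the part t gives the
      L/2 term of \<delta> and the part t^2 goes into the vanishing error.\<close>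
    moreover have "t * (norm y)\<^sup>2 + (norm z)\<^sup>2 = (1 + t) * (norm x)\<^sup>2 + (t + t\<^sup>2) * (norm d)\<^sup>2"
    proof -
      have "y = x + d" by (simp add: d_def)
      then show ?thesis
        unfolding z_def power2_norm_eq_inner
        by (simp add: inner_simps inner_commute power2_eq_square algebra_simps)
    qed
    then have "L / 2 * (t * (norm y)\<^sup>2 + (norm z)\<^sup>2)
        = L / 2 * ((1 + t) * (norm x)\<^sup>2 + (t + t\<^sup>2) * (norm d)\<^sup>2)"
      by simp
    ultimately have "t * \<delta> \<le> t * (t * ((L + M) / 2 * (norm d)\<^sup>2))"
      unfolding \<delta>_def q_def by (simp add: algebra_simps power2_eq_square add_divide_distrib)
    then show ?thesis using t by simp
  qed
  then have "\<delta> \<le> 0" by (rule nonpos_if_le_mult_small)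
  then show ?thesis by (simp add: \<delta>_def d_def)
qed

text \<open>
  The two-sided bounds at \<open>x\<close> and \<open>y\<close> are compared at the two points \<open>m \<plusminus> u\<close>, where \<open>m\<close> is the
  midpoint of \<open>x\<close> and \<open>y\<close> and \<open>u = (g - h) / (2 M)\<close>.
\<close>

lemma two_sided_quadratic_bound_Lipschitz:
  fixes f :: "'a::real_inner \<Rightarrow> real"
  assumes "0 < M"
    and x: "\<And>z. \<bar>f z - f x - g \<bullet> (z - x)\<bar> \<le> M / 2 * (norm (z - x))\<^sup>2"
    and y: "\<And>z. \<bar>f z - f y - h \<bullet> (z - y)\<bar> \<le> M / 2 * (norm (z - y))\<^sup>2"
  shows "norm (g - h) \<le> M * norm (x - y)"
proof -
  define e where "e = (1 / 2) *\<^sub>R (x - y)"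
  define m where "m = (1 / 2) *\<^sub>R (x + y)"
  define u where "u = (1 / (2 * M)) *\<^sub>R (g - h)"
  have xm: "x = m + e" and ym: "y = m - e"
    by (simp_all add: m_def e_def algebra_simps flip: scaleR_add_left)
  \<comment> \<open>At m + u, combine the lower bound from x with the upper bound from y; at m - u,
    exchange the roles of x and y. All values of f cancel in the sum.\<close>
  have "2 * ((g - h) \<bullet> u) \<le> M / 2 * ((norm (u - e))\<^sup>2 + (norm (u + e))\<^sup>2
      + (norm (- u - e))\<^sup>2 + (norm (- u + e))\<^sup>2)"
  proof -
    have eqs: "m + u - x = u - e" "m + u - y = u + e" "m - u - x = - u - e" "m - u - y = - u + e"
      by (simp_all add: xm ym)
    have "g \<bullet> (u - e) - g \<bullet> (- u - e) - (h \<bullet> (u + e) - h \<bullet> (- u + e)) = 2 * ((g - h) \<bullet> u)"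
      by (simp add: inner_simps)
    then show ?thesis
      using x[of "m + u"] y[of "m + u"] x[of "m - u"] y[of "m - u"]
      unfolding eqs abs_le_iff distrib_left by linarith
  qed
  also have "\<dots> = 2 * M * ((norm u)\<^sup>2 + (norm e)\<^sup>2)"
    by (simp add: power2_norm_eq_inner inner_simps inner_commute algebra_simps)
  finally have "(g - h) \<bullet> u \<le> M * (norm u)\<^sup>2 + M * (norm e)\<^sup>2"
    by (simp add: algebra_simps)
  \<comment> \<open>This \<open>u\<close> maximizes (g - h) \<bullet> u - M |u|^2, with maximum |g -
    h|^2 / (4 M).\<close>
  moreover have "(g - h) \<bullet> u = (norm (g - h))\<^sup>2 / (2 * M)"
    by (simp add: u_def power2_norm_eq_inner)
  moreover have "M * (norm u)\<^sup>2 = (norm (g - h))\<^sup>2 / (4 * M)"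
    using \<open>0 < M\<close> by (simp add: u_def power_mult_distrib power_divide) (simp add: power2_eq_square)
  moreover have "M * (norm e)\<^sup>2 = M * ((norm (x - y))\<^sup>2 / 4)"
    by (simp add: e_def power_divide)
  moreover have "(norm (g - h))\<^sup>2 / (2 * M) = 2 * ((norm (g - h))\<^sup>2 / (4 * M))"
    by simp
  ultimately have "(norm (g - h))\<^sup>2 / (4 * M) \<le> M * ((norm (x - y))\<^sup>2 / 4)"
    by linarith
  then have "(norm (g - h))\<^sup>2 \<le> M * ((norm (x - y))\<^sup>2 / 4) * (4 * M)"
    using \<open>0 < M\<close> by (subst (asm) pos_divide_le_eq) simp_all
  also have "\<dots> = (M * norm (x - y))\<^sup>2"
    by (simp add: power2_eq_square)
  finally have "(norm (g - h))\<^sup>2 \<le> (M * norm (x - y))\<^sup>2" .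
  then show ?thesis
    by (rule power2_le_imp_le) (use \<open>0 < M\<close> in simp)
qed

text \<open>Compare x with a point p on the segment to w: minimality bounds f p below, strong
  convexity bounds it above. Divide by t and let t tend to 0.\<close>

lemma strongly_convex_arg_min:
  fixes f :: "'a::real_inner \<Rightarrow> ereal"
  assumes conv: "ext_convex (\<lambda>x. f x - ereal (\<mu> / 2 * (norm x)\<^sup>2))"
    and am: "is_arg_min (\<lambda>w. f w - ereal (g \<bullet> w)) (\<lambda>_. True) x"
    and fx: "f x = ereal b" and fw: "f w = ereal a"
  shows "b + g \<bullet> (w - x) + \<mu> / 2 * (norm (w - x))\<^sup>2 \<le> a"
proof -
  define Q where "Q = \<mu> / 2 * (norm (w - x))\<^sup>2"
  have "b + g \<bullet> (w - x) + Q - a \<le> t * Q" if t: "0 < t" "t < 1" for t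
  proof -
    define p where "p = (1 - t) *\<^sub>R x + t *\<^sub>R w"
    have up: "f p - ereal (\<mu> / 2 * (norm p)\<^sup>2)
      \<le> ereal (1 - t) * (f x - ereal (\<mu> / 2 * (norm x)\<^sup>2)) + ereal t * (f w - ereal (\<mu> / 2 * (norm w)\<^sup>2))"
      using conv t unfolding ext_convex_def p_def by simp
    have lo: "f x - ereal (g \<bullet> x) \<le> f p - ereal (g \<bullet> p)"
      using am by (simp add: is_arg_min_def not_less)
    \<comment> \<open>Convexity excludes the value \<infinity>, minimality excludes
      -\<infinity>.\<close>
    obtain c where c: "f p = ereal c"
      using up lo by (cases "f p") (auto simp: fx fw)
    have "c - \<mu> / 2 * (norm p)\<^sup>2 \<le> (1 - t) * (b - \<mu> / 2 * (norm x)\<^sup>2) + t * (a - \<mu> / 2 * (norm w)\<^sup>2)"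
      using up by (simp add: fx fw c)
    moreover have "b - g \<bullet> x \<le> c - g \<bullet> p"
      using lo by (simp add: fx c)
    moreover have "g \<bullet> p = g \<bullet> x + t * (g \<bullet> (w - x))"
      by (simp add: p_def inner_simps algebra_simps)
    moreover have "\<mu> / 2 * (norm p)\<^sup>2
        = (1 - t) * (\<mu> / 2 * (norm x)\<^sup>2) + t * (\<mu> / 2 * (norm w)\<^sup>2) - t * (1 - t) * Q"
      by (simp add: Q_def p_def power2_norm_eq_inner inner_simps inner_commute field_simps)
    ultimately have "t * (b + g \<bullet> (w - x) + Q - a) \<le> t * (t * Q)"
      by (simp add: algebra_simps)
    then show ?thesis using t by simp
  qed
  then have "b + g \<bullet> (w - x) + Q - a \<le> 0" by (rule nonpos_if_le_mult_small)
  then show ?thesis by (simp add: Q_def)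
qed

lemma arg_min_finite:
  assumes "proper_fun f" and "is_arg_min (\<lambda>w. f w - ereal (h w)) (\<lambda>_. True) x"
  shows "\<bar>f x\<bar> \<noteq> \<infinity>"
proof -
  obtain w where "f w \<noteq> \<infinity>"
    using assms(1) by (auto simp: proper_fun_def)
  moreover have "f x - ereal (h x) \<le> f w - ereal (h w)"
    using assms(2) by (simp add: is_arg_min_def not_less)
  moreover have "f x \<noteq> -\<infinity>" "f w \<noteq> -\<infinity>"
    using assms(1) by (auto simp: proper_fun_def)
  ultimately show ?thesis
    by (cases "f x"; cases "f w") auto
qed

lemma convex_subdiff_finite:
  assumes "proper_fun f" and "g \<in> convex_subdiff f x"
  shows "\<bar>f x\<bar> \<noteq> \<infinity>"
proof -
  obtain w where "f w \<noteq> \<infinity>"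
    using assms(1) by (auto simp: proper_fun_def)
  moreover have "f x + ereal (g \<bullet> (w - x)) \<le> f w"
    using assms(2) by (simp add: convex_subdiff_def)
  ultimately show ?thesis
    using assms(1) by (cases "f x") (auto simp: proper_fun_def)
qed

text \<open>Expanding |y|^2 around x, the linear part \<mu> x \<bullet> (y - x) is exactly the shift
  built into \<open>subdiff\<close>; the squared distance remains.\<close>

lemma subdiff_lower_bound:
  assumes "g \<in> subdiff \<mu> f x" and "\<mu> < 0" and f: "f = (\<lambda>z. ereal (h z))"
  shows "h x + g \<bullet> (y - x) + \<mu> / 2 * (norm (y - x))\<^sup>2 \<le> h y"
proof -
  obtain s where s: "s \<in> convex_subdiff (\<lambda>z. f z - ereal (\<mu> / 2 * (norm z)\<^sup>2)) x"
    and g: "g = s + \<mu> *\<^sub>R x"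
    using assms(1,2) by (auto simp: subdiff_def)
  have "h x - \<mu> / 2 * (norm x)\<^sup>2 + s \<bullet> (y - x) \<le> h y - \<mu> / 2 * (norm y)\<^sup>2"
    using s by (simp add: convex_subdiff_def f)
  then show ?thesis
    by (simp add: g power2_norm_eq_inner inner_simps inner_commute field_simps)
qed

text \<open>With \<rho> = \<mu> / \<nu>, the relation \<mu> = \<nu> \<rho> merges each odd power
  with the next even one: \<mu> (\<rho>^(2N+1) + \<rho>^(2N+2)) = (\<mu> + \<nu>)
  \<rho>^(2N+2).\<close>

lemma geometric_coefficient:
  fixes \<mu> \<nu> :: real
  assumes "\<mu> \<noteq> 0" "\<nu> \<noteq> 0"
  shows "\<mu> + \<nu> + \<mu> * E_sum N (\<nu> / \<mu>) = (\<mu> + \<nu>) * (\<Sum>k\<le>N. (\<mu> / \<nu>) ^ (2 * k))"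
proof (induction N)
  case 0
  show ?case by (simp add: E_sum_def)
next
  case (Suc N)
  have "E_sum n (\<nu> / \<mu>) = (\<Sum>j=1..2 * n. (\<mu> / \<nu>) ^ j)" for n
    unfolding E_sum_def by (simp add: power_int_minus flip: power_inverse)
  then have "E_sum (Suc N) (\<nu> / \<mu>)
      = E_sum N (\<nu> / \<mu>) + (\<mu> / \<nu>) ^ (2 * N + 1) + (\<mu> / \<nu>) ^ (2 * N + 2)"
    by simp
  then have "\<mu> + \<nu> + \<mu> * E_sum (Suc N) (\<nu> / \<mu>)
      = (\<mu> + \<nu>) * (\<Sum>k\<le>N. (\<mu> / \<nu>) ^ (2 * k))
        + \<mu> * ((\<mu> / \<nu>) ^ (2 * N + 1) + (\<mu> / \<nu>) ^ (2 * N + 2))"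
    using Suc.IH by (simp add: algebra_simps)
  also have "\<mu> * ((\<mu> / \<nu>) ^ (2 * N + 1) + (\<mu> / \<nu>) ^ (2 * N + 2))
      = (\<mu> + \<nu>) * (\<mu> / \<nu>) ^ (2 * Suc N)"
    using assms by (simp add: field_simps)
  finally show ?case by (simp add: algebra_simps)
qed

theorem theorem3:
  fixes f1 f2 :: "'a::euclidean_space \<Rightarrow> ereal"
    and \<mu>1 \<mu>2 :: real and L1 L2 :: ereal
    and N :: nat and x :: "nat \<Rightarrow> 'a"
  assumes "standing_assumption \<mu>1 L1 \<mu>2 L2 f1 f2"
    and "\<mu>1 + \<mu>2 > 0"
    and "L2 + ereal \<mu>2 \<le> 0"
    and "N \<ge> 1"
    and "x 0 \<in> dom_subdiff \<mu>1 f1"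
    and "\<And>k. k \<le> N \<Longrightarrow> dca_step \<mu>2 f1 f2 (x k) (x (Suc k))"
  shows "ereal (1 / 2 * (norm (x N - x (N + 1)))\<^sup>2)
    \<le> (dc_fun f1 f2 (x 0) - dc_fun f1 f2 (x (N + 1)))
        / ereal (\<mu>1 + \<mu>2 + \<mu>1 * E_sum N (\<mu>2 / \<mu>1))"
proof -
  have f1: "proper_fun f1" "ext_convex (\<lambda>x. f1 x - ereal (\<mu>1 / 2 * (norm x)\<^sup>2))" "0 \<le> \<mu>1"
    and f2: "f2 \<in> curv_class \<mu>2 L2" "ereal \<mu>2 < L2"
    using assms(1) by (auto simp: standing_assumption_def curv_class_def)
  obtain L where L: "L2 = ereal L"
    using f2(2) assms(3) by (cases L2) auto
  have "\<mu>2 < L" "L \<le> - \<mu>2"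
    using f2(2) assms(3) by (auto simp: L)
  \<comment> \<open>From \<mu>2 < L \<le> -\<mu>2 it follows that \<mu>2 < 0, so M is a positive
    Lipschitz constant; M < \<mu>1 makes the ratio \<open>r\<close> below exceed 1.\<close>
  define M where "M = - \<mu>2"
  have M: "0 < M" "M < \<mu>1" "L \<le> M"
    using \<open>\<mu>2 < L\<close> \<open>L \<le> - \<mu>2\<close> assms(2) by (auto simp: M_def)
  define h where "h z = real_of_ereal (f2 z)" for z
  have f2h: "f2 = (\<lambda>z. ereal (h z))"
    using f2(1) by (auto simp: curv_class_def L h_def ereal_real)
  have conv2: "convex_on UNIV (\<lambda>z. L / 2 * (norm z)\<^sup>2 - h z)"
    using f2(1) by (simp add: curv_class_def L f2h flip: ext_convex_ereal_iff)

  obtain g where g: "\<And>k. k \<le> N \<Longrightarrow> g k \<in> subdiff \<mu>2 f2 (x k)"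
    and am: "\<And>k. k \<le> N \<Longrightarrow> is_arg_min (\<lambda>w. f1 w - ereal (g k \<bullet> w)) (\<lambda>_. True) (x (Suc k))"
    using assms(6) unfolding dca_step_def by metis

  define a where "a k = real_of_ereal (f1 (x k))" for k
  have fin: "f1 (x k) = ereal (a k)" if "k \<le> Suc N" for k
  proof -
    have "\<bar>f1 (x k)\<bar> \<noteq> \<infinity>"
    \<comment> \<open>The starting point has a subgradient of f1; every later iterate minimizes a
      linear perturbation of f1.\<close>
    proof (cases k)
      case 0
      then show ?thesis
        using assms(5) f1(3) convex_subdiff_finite[OF f1(1)]
        by (fastforce simp: dom_subdiff_def subdiff_def)
    next
      case (Suc j)
      then show ?thesis
        using that arg_min_finite[OF f1(1) am[of j]] by simp
    qed
    then show ?thesis by (simp add: a_def ereal_real)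
  qed
  have sc: "a (Suc k) + g k \<bullet> (x j - x (Suc k)) + \<mu>1 / 2 * (norm (x j - x (Suc k)))\<^sup>2 \<le> a j"
    if "k \<le> N" "j \<le> Suc N" for k j
    using strongly_convex_arg_min[OF f1(2) am[OF that(1)] fin fin] that by simp

  have low: "h (x k) + g k \<bullet> (z - x k) - M / 2 * (norm (z - x k))\<^sup>2 \<le> h z" if "k \<le> N" for k z
    using subdiff_lower_bound[OF g[OF that] _ f2h, of z] M(1) by (simp add: M_def)
  have two: "\<bar>h z - h (x k) - g k \<bullet> (z - x k)\<bar> \<le> M / 2 * (norm (z - x k))\<^sup>2" if "k \<le> N" for k z
  proof -
    have "h z \<le> h (x k) + g k \<bullet> (z - x k) + L / 2 * (norm (z - x k))\<^sup>2"
      by (rule quadratic_upper_bound[OF conv2 low[OF that]])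
    moreover have "L / 2 * (norm (z - x k))\<^sup>2 \<le> M / 2 * (norm (z - x k))\<^sup>2"
      using M(3) by (intro mult_right_mono) auto
    ultimately show ?thesis
      using low[OF that, of z] unfolding abs_le_iff by linarith
  qed

  define D where "D k = norm (x k - x (Suc k))" for k
  define F where "F k = a k - h (x k)" for k
  define r where "r = \<mu>1 / M"
  have "0 < r" using M by (simp add: r_def)
  \<comment> \<open>Test the bound for f1 at x (k+1) in x k and the bound for f2 at x k in x (k+1);
    the terms with g k cancel in the sum.\<close>
  have decrease: "(\<mu>1 + \<mu>2) / 2 * (D k)\<^sup>2 \<le> F k - F (Suc k)" if "k \<le> N" for k
    using sc[OF that, of k] low[OF that, of "x (Suc k)"] that
    by (simp add: F_def D_def M_def norm_minus_commute inner_diff_right field_simps)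

  have contract: "r * D (Suc k) \<le> D k" if k: "Suc k \<le> N" for k
  proof -
    let ?d = "x (Suc k) - x (Suc (Suc k))"
    \<comment> \<open>Strong monotonicity: g k and g (k+1) are subgradients of f1 at x (k+1) and x
      (k+2), one index later than for f2.\<close>
    have "\<mu>1 * (D (Suc k))\<^sup>2 \<le> (g k - g (Suc k)) \<bullet> ?d"
      using sc[of k "Suc (Suc k)"] sc[of "Suc k" "Suc k"] k
      by (simp add: D_def norm_minus_commute inner_simps algebra_simps)
    also have "\<dots> \<le> norm (g k - g (Suc k)) * D (Suc k)"
      unfolding D_def by (rule norm_cauchy_schwarz)
    also have "\<dots> \<le> M * D k * D (Suc k)"
      using two_sided_quadratic_bound_Lipschitz[OF M(1) two two, of k "Suc k"] k
      by (intro mult_right_mono) (auto simp: D_def)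
    finally have "D (Suc k) * (\<mu>1 * D (Suc k)) \<le> D (Suc k) * (M * D k)"
      by (simp add: power2_eq_square mult_ac)
    moreover have "0 \<le> D k" "0 \<le> D (Suc k)" by (simp_all add: D_def)
    \<comment> \<open>If the iterates coincide, the common factor cannot be cancelled, but the claim
      is trivial.\<close>
    ultimately have "\<mu>1 * D (Suc k) \<le> M * D k"
      using M by (cases "D (Suc k) = 0") auto
    then show ?thesis using M by (simp add: r_def field_simps)
  qed
  \<comment> \<open>Counting back from the last step bounds every earlier step below by D N.\<close>
  have geo: "r ^ j * D N \<le> D (N - j)" if "j \<le> N" for j
    using that
  proof (induction j)
    case (Suc j)
    have "r ^ Suc j * D N \<le> r * D (N - j)"
      using Suc \<open>0 < r\<close> by (simp add: mult.assoc)
    also have "\<dots> \<le> D (N - Suc j)"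
      using contract[of "N - Suc j"] Suc.prems by (simp add: Suc_diff_Suc)
    finally show ?case .
  qed simp

  define C where "C = (\<mu>1 + \<mu>2) * (\<Sum>k\<le>N. r ^ (2 * k))"
  \<comment> \<open>Here \<mu>1 / \<mu>2 = -r; the sign disappears because only even powers
    occur.\<close>
  have C_eq: "\<mu>1 + \<mu>2 + \<mu>1 * E_sum N (\<mu>2 / \<mu>1) = C"
    using geometric_coefficient[of \<mu>1 \<mu>2 N] M by (simp add: C_def r_def M_def power_mult)
  have "0 < C"
    unfolding C_def using assms(2) \<open>0 < r\<close> by (intro mult_pos_pos sum_pos) auto
  have "C / 2 * (D N)\<^sup>2 = (\<Sum>k\<le>N. (\<mu>1 + \<mu>2) / 2 * (r ^ k * D N)\<^sup>2)"
    by (simp add: C_def sum_distrib_left sum_distrib_right sum_divide_distrib power_mult_distrib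
        mult_ac flip: power_mult)
  also have "\<dots> \<le> (\<Sum>k\<le>N. (\<mu>1 + \<mu>2) / 2 * (D (N - k))\<^sup>2)"
    using assms(2) geo \<open>0 < r\<close>
    by (intro sum_mono mult_left_mono power_mono) (auto simp: D_def)
  also have "\<dots> = (\<Sum>k\<le>N. (\<mu>1 + \<mu>2) / 2 * (D k)\<^sup>2)"
    by (rule sum.reindex_bij_witness[of _ "\<lambda>k. N - k" "\<lambda>k. N - k"]) auto
  also have "\<dots> \<le> (\<Sum>k\<le>N. F k - F (Suc k))"
    by (intro sum_mono decrease) simp
  also have "\<dots> = F 0 - F (Suc N)"
    by (rule sum_telescope)
  finally have "1 / 2 * (D N)\<^sup>2 \<le> (F 0 - F (Suc N)) / C"
    using \<open>0 < C\<close> by (simp add: field_simps)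
  moreover have "dc_fun f1 f2 (x k) = ereal (F k)" if "k \<le> Suc N" for k
    using fin[OF that] by (simp add: dc_fun_def F_def f2h)
  ultimately show ?thesis
    using \<open>0 < C\<close> by (simp add: C_eq D_def)
qed

end
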